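(* Let $(X,d_X)$ be a metric space; for points $x_1,x_2,x_3,x_4\in X$ write $d_{ij}:=d_X(x_i,x_j)$. The following are equivalent: 1. $X$ can be isometrically embedded in an $\mathbb{R}$-tree. 2. All $x_1,x_2,x_3,x_4\in X$ satisfy the 4-point condition $$d_{13}+d_{24}\le \max(d_{12}+d_{34},\,d_{23}+d_{41}).$$ 3. All $x_1,x_2,x_3,x_4\in X$ satisfy the $\kappa$-Ptolemy inequality $$s_\kappa(d_{13}/2)\,s_\kappa(d_{24}/2)\le s_\kappa(d_{12}/2)\,s_\kappa(d_{34}/2)+s_\kappa(d_{23}/2)\,s_\kappa(d_{41}/2)$$ for all $\kappa\in\mathbb{R}$ such that $d_{12}+d_{23}+d_{34}+d_{41}<2D_\kappa$.
   Context: For $\kappa\in\mathbb{R}$, $D_\kappa:=\pi/\sqrt{\kappa}$ if $\kappa>0$ and $D_\kappa:=\infty$ if $\kappa\le 0$. The function $s_\kappa:[0,\infty)\to\mathbb{R}$ is defined by $s_\kappa(t)=\frac{1}{\sqrt{\kappa}}\sin(\sqrt{\kappa}\,t)$ if $\kappa>0$, $s_0(t)=t$, and $s_\kappa(t)=\frac{1}{\sqrt{-\kappa}}\sinh(\sqrt{-\kappa}\,t)$ if $\kappa<0$. An isometric embedding is a map $f:(X,d_X)\to(Y,d_Y)$ with $d_Y(f(x),f(x'))=d_X(x,x')$ for all $x,x'\in X$. An $\mathbb{R}$-tree is a metric space $T$ such that: (i) for every pair of points $x,y\in T$ there is a unique geodesic segment $[x,y]\subset T$ joining them (a geodesic segment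 joining $x$ and $y$ is the image of an isometric embedding of the interval $[0,d_T(x,y)]$ into $T$ with endpoints mapped to $x$ and $y$); (ii) if $[y,x]\cap[x,z]=\{x\}$, then $[y,x]\cup[x,z]=[y,z]$. The points $x_1,x_2,x_3,x_4$ are not assumed to be distinct. *)

theory Defs
  imports "HOL-Analysis.Analysis"
begin

definition isometric_embedding ::
  "'a set \<Rightarrow> ('a \<Rightarrow> 'a \<Rightarrow> real) \<Rightarrow> 'b set \<Rightarrow> ('b \<Rightarrow> 'b \<Rightarrow> real) \<Rightarrow> ('a \<Rightarrow> 'b) \<Rightarrow> bool"
  where "isometric_embedding X dX Y dY f \<longleftrightarrow>
    f \<in> X \<rightarrow> Y \<and> (\<forall>x\<in>X. \<forall>x'\<in>X. dY (f x) (f x') = dX x x')"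

definition geodesic_segment ::
  "'a set \<Rightarrow> ('a \<Rightarrow> 'a \<Rightarrow> real) \<Rightarrow> 'a \<Rightarrow> 'a \<Rightarrow> 'a set \<Rightarrow> bool"
  where "geodesic_segment T dT x y S \<longleftrightarrow>
    (\<exists>\<gamma>. isometric_embedding {0..dT x y} dist T dT \<gamma> \<and>
         \<gamma> 0 = x \<and> \<gamma> (dT x y) = y \<and> S = \<gamma> ` {0..dT x y})"

(* The segments written [x,y] in the second axiom are named by a universally quantified set
   satisfying geodesic_segment; they are unique by the first axiom. *)
definition R_tree :: "'a set \<Rightarrow> ('a \<Rightarrow> 'a \<Rightarrow> real) \<Rightarrow> bool"
  where "R_tree T dT \<longleftrightarrow>
    Metric_space T dT \<and>
    (\<forall>x\<in>T. \<forall>y\<in>T. \<exists>!S. geodesic_segment T dT x y S) \<and>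
    (\<forall>x\<in>T. \<forall>y\<in>T. \<forall>z\<in>T. \<forall>S1 S2 S3.
       geodesic_segment T dT y x S1 \<longrightarrow> geodesic_segment T dT x z S2 \<longrightarrow>
       geodesic_segment T dT y z S3 \<longrightarrow> S1 \<inter> S2 = {x} \<longrightarrow> S1 \<union> S2 = S3)"

definition four_point :: "'a set \<Rightarrow> ('a \<Rightarrow> 'a \<Rightarrow> real) \<Rightarrow> bool"
  where "four_point X d \<longleftrightarrow>
    (\<forall>x1\<in>X. \<forall>x2\<in>X. \<forall>x3\<in>X. \<forall>x4\<in>X.
       d x1 x3 + d x2 x4 \<le> max (d x1 x2 + d x3 x4) (d x2 x3 + d x4 x1))"

definition D_kappa :: "real \<Rightarrow> ereal"
  where "D_kappa \<kappa> = (if \<kappa> > 0 then ereal (pi / sqrt \<kappa>) else \<infinity>)"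

(* Only arguments t \<ge> 0 are relevant; the value elsewhere is that of the same formula. *)
definition s_kappa :: "real \<Rightarrow> real \<Rightarrow> real"
  where "s_kappa \<kappa> t =
    (if \<kappa> > 0 then 1 / sqrt \<kappa> * sin (sqrt \<kappa> * t)
     else if \<kappa> = 0 then t
     else 1 / sqrt (- \<kappa>) * sinh (sqrt (- \<kappa>) * t))"

definition kappa_ptolemy :: "'a set \<Rightarrow> ('a \<Rightarrow> 'a \<Rightarrow> real) \<Rightarrow> bool"
  where "kappa_ptolemy X d \<longleftrightarrow>
    (\<forall>x1\<in>X. \<forall>x2\<in>X. \<forall>x3\<in>X. \<forall>x4\<in>X. \<forall>\<kappa>.
       ereal (d x1 x2 + d x2 x3 + d x3 x4 + d x4 x1) < 2 * D_kappa \<kappa> \<longrightarrow>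
       s_kappa \<kappa> (d x1 x3 / 2) * s_kappa \<kappa> (d x2 x4 / 2)
         \<le> s_kappa \<kappa> (d x1 x2 / 2) * s_kappa \<kappa> (d x3 x4 / 2)
           + s_kappa \<kappa> (d x2 x3 / 2) * s_kappa \<kappa> (d x4 x1 / 2))"

(* HOL cannot quantify existentially over types, so the ambient type of the tree is a parameter. *)
definition embeds_in_R_tree :: "'t itself \<Rightarrow> 'a set \<Rightarrow> ('a \<Rightarrow> 'a \<Rightarrow> real) \<Rightarrow> bool"
  where "embeds_in_R_tree _ X d \<longleftrightarrow>
    (\<exists>(T :: 't set) dT f. R_tree T dT \<and> isometric_embedding X d T dT f)"

end

theory Submission
  imports Defs
begin

text \<open>Every \<open>s_kappa\<close> satisfies \<open>s (c + a) * s (c + b) = s (c + a + b) * s c + s a * s b\<close>, which together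
  with monotonicity and the triangle inequality turns the four-point condition into the Ptolemy
  inequalities; conversely, as \<open>\<kappa>\<close> tends to \<open>-\<infinity>\<close>, products of values of \<open>sinh\<close> compare like the
  maxima of the sums of their arguments. In a tree the segments from a point \<open>x\<close> to \<open>y\<close> and \<open>z\<close> run
  together exactly up to the height given by the Gromov product, so that Gromov products are
  ultrametric, which is the four-point condition. Conversely, gluing for each \<open>x\<close> a segment of
  length \<open>d b x\<close> to a base point \<open>b\<close> along Gromov products yields a geodesic space with the
  four-point condition, and every such space is a tree.\<close>

section \<open>Ptolemy inequalities and the four-point condition\<close>

text \<open>This is Ptolemy's equality for four points on a line with consecutive gaps
  \<open>a\<close>, \<open>c\<close>, \<open>b\<close>. It follows from the addition theorems after
  multiplying by \<open>sin^2 + cos^2 = 1\<close> or \<open>cosh^2 - sinh^2 = 1\<close>.\<close>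

lemma s_kappa_ptolemy_identity:
  "s_kappa \<kappa> (c + a) * s_kappa \<kappa> (c + b)
     = s_kappa \<kappa> (c + a + b) * s_kappa \<kappa> c + s_kappa \<kappa> a * s_kappa \<kappa> b"
proof -
  have sin: "sin (x + y) * sin (x + z) = sin (x + y + z) * sin x + sin y * sin z" for x y z :: real
  proof -
    have "sin y * sin z = (sin x ^ 2 + cos x ^ 2) * (sin y * sin z)" by simp
    also have "\<dots> = sin (x + y) * sin (x + z) - sin (x + y + z) * sin x"
      by (simp add: sin_add cos_add algebra_simps power2_eq_square del: sin_cos_squared_add sin_cos_squared_add3)
    finally show ?thesis by simp
  qed
  have sinh: "sinh (x + y) * sinh (x + z) = sinh (x + y + z) * sinh x + sinh y * sinh z"
    for x y z :: real
  proof -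
    have "sinh y * sinh z = (cosh x ^ 2 - sinh x ^ 2) * (sinh y * sinh z)"
      by (simp add: hyperbolic_pythagoras)
    also have "\<dots> = sinh (x + y) * sinh (x + z) - sinh (x + y + z) * sinh x"
      by (simp add: sinh_add cosh_add algebra_simps power2_eq_square)
    finally show ?thesis by simp
  qed
  show ?thesis
    using sin[of "sqrt \<kappa> * c" "sqrt \<kappa> * a" "sqrt \<kappa> * b"]
      sinh[of "sqrt (- \<kappa>) * c" "sqrt (- \<kappa>) * a" "sqrt (- \<kappa>) * b"]
    by (auto simp: s_kappa_def algebra_simps simp flip: add_divide_distrib)
qed

lemma s_kappa_minus: "s_kappa \<kappa> (- x) = - s_kappa \<kappa> x"
  by (simp add: s_kappa_def)

lemma s_kappa_mono:
  assumes "x \<le> y" and "\<kappa> > 0 \<Longrightarrow> - (pi / 2) \<le> sqrt \<kappa> * x" and "\<kappa> > 0 \<Longrightarrow> sqrt \<kappa> * y \<le> pi / 2"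
  shows "s_kappa \<kappa> x \<le> s_kappa \<kappa> y"
proof (cases "\<kappa> > 0")
  case True
  with assms show ?thesis
    by (auto simp: s_kappa_def intro!: divide_right_mono sin_monotone_2pi_le mult_left_mono)
next
  case False
  with assms show ?thesis
    by (auto simp: s_kappa_def divide_le_cancel)
qed

text \<open>Odd symmetry allows arguments of either sign, such as differences of distances.\<close>

lemma s_kappa_abs_le:
  assumes "\<bar>x\<bar> \<le> y" and "\<kappa> > 0 \<Longrightarrow> sqrt \<kappa> * y \<le> pi / 2"
  shows "\<bar>s_kappa \<kappa> x\<bar> \<le> s_kappa \<kappa> y"
proof -
  have le: "s_kappa \<kappa> z \<le> s_kappa \<kappa> y" if "- y \<le> z" "z \<le> y" for z
  proof (rule s_kappa_mono)
    assume "\<kappa> > 0"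
    then have "sqrt \<kappa> * (- y) \<le> sqrt \<kappa> * z"
      using that by (intro mult_left_mono) auto
    then show "- (pi / 2) \<le> sqrt \<kappa> * z"
      using assms(2)[OF \<open>\<kappa> > 0\<close>] by simp
  qed (use that assms in auto)
  show ?thesis
    using le[of x] le[of "- x"] assms(1) by (simp add: s_kappa_minus abs_le_iff)
qed

lemma s_kappa_nonneg:
  assumes "0 \<le> x" and "\<kappa> > 0 \<Longrightarrow> sqrt \<kappa> * x \<le> pi / 2"
  shows "0 \<le> s_kappa \<kappa> x"
  using s_kappa_abs_le[of x x \<kappa>] assms by simp

lemma sinh_le_exp: "sinh x \<le> exp x / 2" for x :: real
  by (simp add: sinh_def)

lemma exp_le_sinh:
  fixes x :: real
  assumes "1 \<le> x"
  shows "exp x / 4 \<le> sinh x"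
proof -
  have "1 + 2 * x \<le> exp (2 * x)"
    by (rule exp_ge_add_one_self)
  with assms have "2 \<le> exp (2 * x)" by linarith
  then have "2 * exp (- x) \<le> exp (2 * x) * exp (- x)" by simp
  then have "2 * exp (- x) \<le> exp x" by (simp flip: exp_add)
  then show ?thesis by (simp add: sinh_def)
qed

context Metric_space
begin

lemma s_kappa_ptolemy_of_sum_le:
  assumes M: "x1 \<in> M" "x2 \<in> M" "x3 \<in> M" "x4 \<in> M"
    and per: "\<kappa> > 0 \<Longrightarrow> sqrt \<kappa> * (d x1 x2 + d x2 x3 + d x3 x4 + d x4 x1) \<le> 2 * pi"
    and sum: "d x1 x3 + d x2 x4 \<le> d x1 x2 + d x3 x4"
  shows "s_kappa \<kappa> (d x1 x3 / 2) * s_kappa \<kappa> (d x2 x4 / 2)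
     \<le> s_kappa \<kappa> (d x1 x2 / 2) * s_kappa \<kappa> (d x3 x4 / 2)
       + s_kappa \<kappa> (d x2 x3 / 2) * s_kappa \<kappa> (d x4 x1 / 2)"
proof -
  note tri = triangle[OF M(1,2,3)] triangle[OF M(1,4,3)] triangle[OF M(2,1,4)] triangle[OF M(2,3,4)]
    triangle[OF M(1,2,4)] triangle[OF M(1,4,2)] triangle[OF M(3,2,4)] triangle[OF M(3,4,2)]
    triangle[OF M(4,1,2)] triangle[OF M(2,4,3)] triangle[OF M(4,3,1)] triangle[OF M(4,2,1)]
    triangle[OF M(1,3,4)] triangle[OF M(1,3,2)]
    commute[of x1 x2] commute[of x1 x3] commute[of x1 x4]
    commute[of x2 x3] commute[of x2 x4] commute[of x3 x4]
  let ?S = "d x1 x2 + d x2 x3 + d x3 x4 + d x4 x1"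
  \<comment> \<open>By the triangle inequality each distance is at most half the perimeter, so for
    positive \<kappa> half-distances scaled by \<open>sqrt \<kappa>\<close> stay below
    \<open>pi / 2\<close>, where \<open>s_kappa\<close> is increasing.\<close>
  have range: "sqrt \<kappa> * x \<le> pi / 2" if "\<kappa> > 0" "4 * x \<le> ?S" for x
  proof -
    have "sqrt \<kappa> * (4 * x) \<le> sqrt \<kappa> * ?S"
      using that by (intro mult_left_mono) auto
    with per[OF that(1)] show ?thesis by linarith
  qed
  \<comment> \<open>Enlarging the diagonal \<open>d x1 x3\<close> to \<open>2 * a\<close> makes the two sums equal,
      and then the identity above applies.\<close>
  define a where "a = (d x1 x2 + d x3 x4 - d x2 x4) / 2"
  have "s_kappa \<kappa> (d x1 x3 / 2) \<le> s_kappa \<kappa> a"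
    using sum tri by (intro order.trans[OF abs_ge_self s_kappa_abs_le] range) (auto simp: a_def)
  moreover have "0 \<le> s_kappa \<kappa> (d x2 x4 / 2)"
    using tri by (intro s_kappa_nonneg range) auto
  ultimately have "s_kappa \<kappa> (d x1 x3 / 2) * s_kappa \<kappa> (d x2 x4 / 2)
      \<le> s_kappa \<kappa> a * s_kappa \<kappa> (d x2 x4 / 2)"
    by (rule mult_right_mono)
  also have "\<dots> = s_kappa \<kappa> (d x1 x2 / 2) * s_kappa \<kappa> (d x3 x4 / 2)
      + s_kappa \<kappa> ((d x2 x4 - d x3 x4) / 2) * s_kappa \<kappa> ((d x1 x2 - d x2 x4) / 2)"
    using s_kappa_ptolemy_identity[of \<kappa> "d x3 x4 / 2"
        "(d x2 x4 - d x3 x4) / 2" "(d x1 x2 - d x2 x4) / 2"]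
    by (simp add: a_def diff_divide_distrib add_divide_distrib mult.commute add_diff_eq add.commute)
  \<comment> \<open>Either difference may be negative. In absolute value they are at most
    \<open>d x2 x3\<close> and \<open>d x4 x1\<close>.\<close>
  also have "s_kappa \<kappa> ((d x2 x4 - d x3 x4) / 2) * s_kappa \<kappa> ((d x1 x2 - d x2 x4) / 2)
      \<le> \<bar>s_kappa \<kappa> ((d x2 x4 - d x3 x4) / 2)\<bar> * \<bar>s_kappa \<kappa> ((d x1 x2 - d x2 x4) / 2)\<bar>"
    by (metis abs_ge_self abs_mult)
  also have "\<dots> \<le> s_kappa \<kappa> (d x2 x3 / 2) * s_kappa \<kappa> (d x4 x1 / 2)"
    using tri by (intro mult_mono s_kappa_abs_le s_kappa_nonneg range) auto
  finally show ?thesis by simp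
qed

lemma kappa_ptolemy_if_four_point:
  assumes "four_point M d"
  shows "kappa_ptolemy M d"
  unfolding kappa_ptolemy_def
proof (intro ballI allI impI)
  fix x1 x2 x3 x4 \<kappa>
  assume M: "x1 \<in> M" "x2 \<in> M" "x3 \<in> M" "x4 \<in> M"
    and "ereal (d x1 x2 + d x2 x3 + d x3 x4 + d x4 x1) < 2 * D_kappa \<kappa>"
  then have per: "sqrt \<kappa> * (d x1 x2 + d x2 x3 + d x3 x4 + d x4 x1) \<le> 2 * pi" if "\<kappa> > 0"
    using that by (simp add: D_kappa_def field_simps)
  have "d x1 x3 + d x2 x4 \<le> max (d x1 x2 + d x3 x4) (d x2 x3 + d x4 x1)"
    using assms M by (simp add: four_point_def)
  then consider "d x1 x3 + d x2 x4 \<le> d x1 x2 + d x3 x4" | "d x1 x3 + d x2 x4 \<le> d x2 x3 + d x4 x1"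
    by linarith
  then show "s_kappa \<kappa> (d x1 x3 / 2) * s_kappa \<kappa> (d x2 x4 / 2)
     \<le> s_kappa \<kappa> (d x1 x2 / 2) * s_kappa \<kappa> (d x3 x4 / 2)
       + s_kappa \<kappa> (d x2 x3 / 2) * s_kappa \<kappa> (d x4 x1 / 2)"
  proof cases
    case 1
    with M per show ?thesis by (rule s_kappa_ptolemy_of_sum_le)
  next
    \<comment> \<open>Swapping \<open>x1\<close> and \<open>x3\<close> exchanges the two pairs of
      opposite sides and keeps the diagonals.\<close>
    case 2
    with s_kappa_ptolemy_of_sum_le[OF M(3,2,1,4), of \<kappa>] per show ?thesis
      by (simp add: commute algebra_simps)
  qed
qed

text \<open>For negative \<kappa> the perimeter condition is vacuous. If the diagonals exceeded
  \<open>m\<close>, the left side would grow like \<open>exp (t * (d x1 x3 + d x2 x4))\<close> and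
  the right side at most like \<open>exp (t * m)\<close>.\<close>

lemma four_point_if_kappa_ptolemy:
  assumes "kappa_ptolemy M d"
  shows "four_point M d"
  unfolding four_point_def
proof (intro ballI, rule ccontr)
  fix x1 x2 x3 x4
  assume M: "x1 \<in> M" "x2 \<in> M" "x3 \<in> M" "x4 \<in> M"
  define m where "m = max (d x1 x2 + d x3 x4) (d x2 x3 + d x4 x1)"
  assume "\<not> d x1 x3 + d x2 x4 \<le> max (d x1 x2 + d x3 x4) (d x2 x3 + d x4 x1)"
  then have less: "m < d x1 x3 + d x2 x4" by (simp add: m_def not_le)
  note tri = triangle[OF M(1,2,3)] triangle[OF M(1,4,3)] triangle[OF M(2,1,4)] triangle[OF M(2,3,4)]
    commute[of x1 x4] commute[of x3 x4] commute[of x1 x2] commute[of x2 x3]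
  \<comment> \<open>If one diagonal were zero, its endpoints would coincide and the triangle
    inequality would bound the other by \<open>m\<close>.\<close>
  have pos: "0 < d x1 x3" "0 < d x2 x4"
    using less M tri nonneg[of x1 x3] nonneg[of x2 x4]
    by (auto simp: m_def order.order_iff_strict)
  \<comment> \<open>The first two entries make \<open>exp_le_sinh\<close> applicable to the
    diagonals. The third contradicts the final bound
    \<open>exp (t * (d x1 x3 + d x2 x4 - m)) \<le> 8\<close>.\<close>
  define t where "t = max (1 / d x1 x3) (max (1 / d x2 x4) (8 / (d x1 x3 + d x2 x4 - m)))"
  have t: "1 \<le> t * d x1 x3" "1 \<le> t * d x2 x4" "8 \<le> t * (d x1 x3 + d x2 x4 - m)"
    using pos less by (simp_all add: t_def flip: pos_divide_le_eq)
  then have "0 < t"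
    using pos by (metis less_le_trans mult_pos_pos not_less_iff_gr_or_eq zero_less_mult_pos2 zero_less_one)
  have s: "s_kappa (- (2 * t)\<^sup>2) (x / 2) = sinh (t * x) / (2 * t)" for x
    using \<open>0 < t\<close> by (simp add: s_kappa_def real_sqrt_mult)
  have "s_kappa (- (2 * t)\<^sup>2) (d x1 x3 / 2) * s_kappa (- (2 * t)\<^sup>2) (d x2 x4 / 2)
       \<le> s_kappa (- (2 * t)\<^sup>2) (d x1 x2 / 2) * s_kappa (- (2 * t)\<^sup>2) (d x3 x4 / 2)
         + s_kappa (- (2 * t)\<^sup>2) (d x2 x3 / 2) * s_kappa (- (2 * t)\<^sup>2) (d x4 x1 / 2)"
    using assms M by (auto simp: kappa_ptolemy_def D_kappa_def)
  then have "sinh (t * d x1 x3) * sinh (t * d x2 x4)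
      \<le> sinh (t * d x1 x2) * sinh (t * d x3 x4) + sinh (t * d x2 x3) * sinh (t * d x4 x1)"
    unfolding s using \<open>0 < t\<close> by (simp add: divide_le_cancel flip: add_divide_distrib)
  also have "\<dots> \<le> exp (t * m) / 4 + exp (t * m) / 4"
  proof (rule add_mono)
    have *: "sinh (t * x) * sinh (t * y) \<le> exp (t * m) / 4"
      if "0 \<le> x" "0 \<le> y" "x + y \<le> m" for x y
    proof -
      have "sinh (t * x) * sinh (t * y) \<le> (exp (t * x) / 2) * (exp (t * y) / 2)"
        using that \<open>0 < t\<close> by (intro mult_mono sinh_le_exp) auto
      also have "\<dots> = exp (t * (x + y)) / 4" by (simp add: exp_add algebra_simps)
      also have "\<dots> \<le> exp (t * m) / 4" using that \<open>0 < t\<close> by simp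
      finally show ?thesis .
    qed
    show "sinh (t * d x1 x2) * sinh (t * d x3 x4) \<le> exp (t * m) / 4"
      "sinh (t * d x2 x3) * sinh (t * d x4 x1) \<le> exp (t * m) / 4"
      by (rule *; simp add: m_def)+
  qed
  finally have "sinh (t * d x1 x3) * sinh (t * d x2 x4) \<le> exp (t * m) / 2" by simp
  moreover have "(exp (t * d x1 x3) / 4) * (exp (t * d x2 x4) / 4)
      \<le> sinh (t * d x1 x3) * sinh (t * d x2 x4)"
    using t by (intro mult_mono exp_le_sinh) auto
  ultimately have "exp (t * d x1 x3) * exp (t * d x2 x4) \<le> 8 * exp (t * m)" by simp
  moreover have "exp (t * d x1 x3) * exp (t * d x2 x4)
      = exp (t * (d x1 x3 + d x2 x4 - m)) * exp (t * m)"
    by (simp add: algebra_simps flip: exp_add)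
  ultimately have "exp (t * (d x1 x3 + d x2 x4 - m)) \<le> 8" by simp
  moreover have "1 + t * (d x1 x3 + d x2 x4 - m) \<le> exp (t * (d x1 x3 + d x2 x4 - m))"
    by (rule exp_ge_add_one_self)
  ultimately show False using t by simp
qed

end

section \<open>Trees satisfy the four-point condition\<close>

text \<open>A description of the segment without parametrisation. It agrees with a geodesic segment
  once its points are determined by their distance from \<open>x\<close>.\<close>

definition between :: "'a set \<Rightarrow> ('a \<Rightarrow> 'a \<Rightarrow> real) \<Rightarrow> 'a \<Rightarrow> 'a \<Rightarrow> 'a set"
  where "between T d x y = {p \<in> T. d x p + d p y = d x y}"

context Metric_space
begin

lemma geodesic_point_between:
  assumes "isometric_embedding {0..d x y} dist M d \<gamma>" "\<gamma> 0 = x" "\<gamma> (d x y) = y" "t \<in> {0..d x y}"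
  shows "\<gamma> t \<in> between M d x y" "d x (\<gamma> t) = t"
proof -
  have iso: "d (\<gamma> s) (\<gamma> u) = \<bar>s - u\<bar>" if "s \<in> {0..d x y}" "u \<in> {0..d x y}" for s u
    using assms(1) that by (simp add: isometric_embedding_def dist_real_def)
  have "d x (\<gamma> t) = t"
    using iso[of 0 t] assms by simp
  moreover have "d (\<gamma> t) y = d x y - t"
    using iso[of t "d x y"] assms by simp
  moreover have "\<gamma> t \<in> M"
    using assms by (auto simp: isometric_embedding_def)
  ultimately show "\<gamma> t \<in> between M d x y" "d x (\<gamma> t) = t"
    by (simp_all add: between_def)
qed

lemma geodesic_segment_subset_between:
  assumes "geodesic_segment M d x y S"
  shows "S \<subseteq> between M d x y"
  using assms geodesic_point_between(1) by (fastforce simp: geodesic_segment_def)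

lemma geodesic_segment_imp_point:
  assumes "geodesic_segment M d x y S" "0 \<le> t" "t \<le> d x y"
  shows "\<exists>p\<in>S. d x p = t"
  using assms geodesic_point_between(2) by (fastforce simp: geodesic_segment_def)

lemma geodesic_segment_eq_between:
  assumes S: "geodesic_segment M d x y S"
    and unique: "\<And>p q. p \<in> between M d x y \<Longrightarrow> q \<in> between M d x y \<Longrightarrow> d x p = d x q \<Longrightarrow> p = q"
  shows "S = between M d x y"
proof (rule antisym)
  show "S \<subseteq> between M d x y" by (rule geodesic_segment_subset_between[OF S])
  show "between M d x y \<subseteq> S"
  proof
    fix p assume p: "p \<in> between M d x y"
    then have "d x p \<le> d x y" using nonneg[of p y] by (simp add: between_def del: nonneg)
    then obtain q where "q \<in> S" "d x q = d x p"
      using geodesic_segment_imp_point[OF S] nonneg by blast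
    with \<open>S \<subseteq> between M d x y\<close> p unique show "p \<in> S" by blast
  qed
qed

lemma geodesic_segment_concat:
  assumes M: "x \<in> M" "y \<in> M" "z \<in> M" and add: "d x y + d y z = d x z"
    and S: "geodesic_segment M d x y S" and R: "geodesic_segment M d y z R"
  shows "geodesic_segment M d x z (S \<union> R)"
proof -
  obtain \<gamma> where \<gamma>: "isometric_embedding {0..d x y} dist M d \<gamma>" "\<gamma> 0 = x" "\<gamma> (d x y) = y"
      "S = \<gamma> ` {0..d x y}"
    using S by (auto simp: geodesic_segment_def)
  obtain \<delta> where \<delta>: "isometric_embedding {0..d y z} dist M d \<delta>" "\<delta> 0 = y" "\<delta> (d y z) = z"
      "R = \<delta> ` {0..d y z}"
    using R by (auto simp: geodesic_segment_def)
  define \<eta> where "\<eta> t = (if t \<le> d x y then \<gamma> t else \<delta> (t - d x y))" for t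
  have eta1: "\<eta> t = \<gamma> t" if "t \<le> d x y" for t using that by (simp add: \<eta>_def)
  have eta2: "\<eta> t = \<delta> (t - d x y)" if "d x y \<le> t" for t
    using that \<gamma> \<delta> by (cases "t = d x y") (auto simp: \<eta>_def)
  have in_M: "\<eta> t \<in> M" if "t \<in> {0..d x z}" for t
    using that \<gamma>(1) \<delta>(1) add by (auto simp: isometric_embedding_def \<eta>_def Pi_iff)
  have iso: "d (\<eta> s) (\<eta> t) = t - s" if "0 \<le> s" "s \<le> t" "t \<le> d x z" for s t
  proof -
    consider "t \<le> d x y" | "d x y \<le> s" | "s \<le> d x y" "d x y \<le> t" by linarith
    then show ?thesis
    proof cases
      case 1
      with that \<gamma>(1) show ?thesis
        by (simp add: eta1 isometric_embedding_def dist_real_def)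
    next
      case 2
      with that \<delta>(1) add show ?thesis
        by (simp add: eta2 isometric_embedding_def dist_real_def)
    next
      \<comment> \<open>The path through \<open>y\<close> gives the upper bound
        \<open>t - s\<close>; a smaller distance would make the path from \<open>x\<close> to
        \<open>z\<close> through \<open>\<eta> s\<close> and \<open>\<eta> t\<close> too
        short.\<close>
      case 3
      have s: "d x (\<eta> s) = s" "d (\<eta> s) y = d x y - s"
        using geodesic_point_between[OF \<gamma>(1-3), of s] 3 that by (auto simp: eta1 between_def)
      have t: "d y (\<eta> t) = t - d x y" "d (\<eta> t) z = d x z - t"
        using geodesic_point_between[OF \<delta>(1-3), of "t - d x y"] 3 that add
        by (auto simp: eta2 between_def)
      have "\<eta> s \<in> M" "\<eta> t \<in> M" using in_M that by auto
      then show ?thesis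
        using triangle[of "\<eta> s" y "\<eta> t"] triangle[of x "\<eta> s" z] triangle[of "\<eta> s" "\<eta> t" z] M s t
        by simp
    qed
  qed
  have "isometric_embedding {0..d x z} dist M d \<eta>"
    unfolding isometric_embedding_def
  proof (intro conjI ballI)
    fix s t assume "s \<in> {0..d x z}" "t \<in> {0..d x z}"
    then show "d (\<eta> s) (\<eta> t) = dist s t"
      using iso[of s t] iso[of t s] commute[of "\<eta> s" "\<eta> t"]
      by (cases "s \<le> t") (auto simp: dist_real_def)
  qed (use in_M in auto)
  moreover have "\<eta> 0 = x" "\<eta> (d x z) = z"
    using \<gamma> \<delta> add eta1[of 0] eta2[of "d x z"] nonneg[of y z] nonneg[of x y]
    by (auto simp flip: add simp del: nonneg)
  moreover have "S \<union> R = \<eta> ` {0..d x z}"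
  proof -
    have "{0..d x z} = {0..d x y} \<union> (+) (d x y) ` {0..d y z}"
      using add ivl_disj_un_two_touch(4)[of 0 "d x y" "d x z"] nonneg[of x y] nonneg[of y z]
      by (simp add: add.commute del: nonneg)
    moreover have "\<eta> ` {0..d x y} = S" using \<gamma> eta1 by auto
    moreover have "\<eta> ` (+) (d x y) ` {0..d y z} = R"
      using \<delta>(4) eta2 by (auto simp: image_image simp del: image_add_atLeastAtMost)
    ultimately show ?thesis by (simp add: image_Un)
  qed
  ultimately show ?thesis by (auto simp: geodesic_segment_def)
qed

lemma between_trans:
  assumes "w \<in> between M d x y" "q \<in> between M d w y" "x \<in> M" "y \<in> M"
  shows "q \<in> between M d x y" "d x q = d x w + d w q"
  using assms triangle[of x q y] triangle[of x w q] by (auto simp: between_def)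

lemma between_commute: "between M d x y = between M d y x"
  by (auto simp: between_def commute add.commute)

end

section \<open>Segments and tripods in an R-tree\<close>

locale R_tree_space = Metric_space T d for T :: "'a set" and d +
  assumes R_tree: "R_tree T d"
begin

lemma segment_exists_unique:
  assumes "x \<in> T" "y \<in> T"
  shows "\<exists>!S. geodesic_segment T d x y S"
  using R_tree assms by (simp add: R_tree_def)

lemma segment_exists:
  assumes "x \<in> T" "y \<in> T"
  shows "\<exists>S. geodesic_segment T d x y S"
  using segment_exists_unique[OF assms] by (rule ex1_implies_ex)

lemma segment_unique:
  assumes "x \<in> T" "y \<in> T" "geodesic_segment T d x y S" "geodesic_segment T d x y R"
  shows "S = R"
  using segment_exists_unique[OF assms(1,2)] assms(3,4) by blast

text \<open>Joining segments from \<open>x\<close> to \<open>r\<close> and from \<open>r\<close> to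
  \<open>y\<close> gives a segment through \<open>r\<close>. Uniqueness puts \<open>p\<close> and
  \<open>q\<close> on one segment, where the distance from \<open>x\<close> is the
  parameter.\<close>

lemma between_inj:
  assumes T: "x \<in> T" "y \<in> T" and p: "p \<in> between T d x y" and q: "q \<in> between T d x y"
    and eq: "d x p = d x q"
  shows "p = q"
proof -
  have through: "\<exists>S. geodesic_segment T d x y S \<and> r \<in> S" if r: "r \<in> between T d x y" for r
  proof -
    have "r \<in> T" using r by (simp add: between_def)
    obtain S R where S: "geodesic_segment T d x r S" and R: "geodesic_segment T d r y R"
      using segment_exists T \<open>r \<in> T\<close> by meson
    have "geodesic_segment T d x y (S \<union> R)"
      using r by (intro geodesic_segment_concat[OF _ _ _ _ S R]) (auto simp: T between_def)
    moreover have "r \<in> S"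
      using S geodesic_segment_imp_point[OF S nonneg order.refl]
      by (auto simp: geodesic_segment_def intro!: image_eqI[of _ _ "d x r"])
    ultimately show ?thesis by blast
  qed
  obtain S where S: "geodesic_segment T d x y S" "p \<in> S" "q \<in> S"
    using through[OF p] through[OF q] segment_unique[OF T] by blast
  obtain \<gamma> where \<gamma>: "isometric_embedding {0..d x y} dist T d \<gamma>" "\<gamma> 0 = x" "\<gamma> (d x y) = y"
      "S = \<gamma> ` {0..d x y}"
    using S(1) by (auto simp: geodesic_segment_def)
  obtain s t where "s \<in> {0..d x y}" "p = \<gamma> s" "t \<in> {0..d x y}" "q = \<gamma> t"
    using S \<gamma>(4) by auto
  with eq show ?thesis
    using geodesic_point_between(2)[OF \<gamma>(1-3)] by simp
qed

lemma segment_between: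
  assumes "x \<in> T" "y \<in> T"
  shows "geodesic_segment T d x y (between T d x y)"
  using segment_exists[OF assms] geodesic_segment_eq_between between_inj[OF assms] by metis

lemma between_point_exists:
  assumes "x \<in> T" "y \<in> T" "0 \<le> t" "t \<le> d x y"
  shows "\<exists>p\<in>between T d x y. d x p = t"
  using geodesic_segment_imp_point[OF segment_between] assms by blast

lemma between_union:
  assumes "x \<in> T" "y \<in> T" "z \<in> T" "between T d y x \<inter> between T d x z = {x}"
  shows "between T d y x \<union> between T d x z = between T d y z"
  using R_tree[unfolded R_tree_def, THEN conjunct2, THEN conjunct2, rule_format, OF assms(1-3)
      segment_between segment_between segment_between assms(4)] assms(1-3)
  by simp

text \<open>Past the point \<open>w\<close> where the segments from \<open>x\<close> to
  \<open>y\<close> and \<open>z\<close> separate, they have nothing in common, so the second tree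
  axiom joins the two remaining pieces into the segment from \<open>y\<close> to
  \<open>z\<close>.\<close>

lemma tripod:
  assumes T: "x \<in> T" "y \<in> T" "z \<in> T"
  shows "\<exists>w. w \<in> between T d x y \<and> w \<in> between T d x z \<and> w \<in> between T d y z"
proof -
  obtain \<gamma> where \<gamma>: "isometric_embedding {0..d x y} dist T d \<gamma>" "\<gamma> 0 = x" "\<gamma> (d x y) = y"
    using segment_exists[OF T(1,2)] by (auto simp: geodesic_segment_def)
  note \<gamma>_point = geodesic_point_between[OF \<gamma>]
  have \<gamma>_T: "\<gamma> t \<in> T" if "t \<in> {0..d x y}" for t
    using \<gamma>_point that by (simp add: between_def)
  \<comment> \<open>The centre is the last point of \<open>[x,y]\<close> that lies on \<open>[x,z]\<close>.\<close>
  define K where "K = {t \<in> {0..d x y}. \<gamma> t \<in> between T d x z}"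
  \<comment> \<open>Written as a preimage of a point under a continuous map, \<open>K\<close> is
    seen to be closed, so it has a largest element.\<close>
  have K_eq: "K = {0..d x y} \<inter> (\<lambda>t. t + d (\<gamma> t) z) -` {d x z}"
    using \<gamma>_point \<gamma>_T by (auto simp: K_def between_def)
  have "continuous_on {0..d x y} (\<lambda>t. d (\<gamma> t) z)"
  proof (rule continuous_on_subset[OF lipschitz_on_continuous_on])
    show "1-lipschitz_on {0..d x y} (\<lambda>t. d (\<gamma> t) z)"
    proof (rule lipschitz_onI)
      fix s t assume st: "s \<in> {0..d x y}" "t \<in> {0..d x y}"
      then have "d (\<gamma> s) (\<gamma> t) = dist s t"
        using \<gamma>(1) by (simp add: isometric_embedding_def)
      then show "dist (d (\<gamma> s) z) (d (\<gamma> t) z) \<le> 1 * dist s t"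
        using triangle[OF \<gamma>_T[OF st(1)] \<gamma>_T[OF st(2)] T(3)]
          triangle[OF \<gamma>_T[OF st(2)] \<gamma>_T[OF st(1)] T(3)]
        by (simp add: commute dist_real_def abs_le_iff)
    qed simp
  qed simp
  then have "closed K"
    unfolding K_eq by (intro continuous_closed_preimage continuous_intros) auto
  moreover have "bounded K"
    by (rule bounded_subset[of "{0..d x y}"]) (auto simp: K_def)
  ultimately have "compact K" by (simp add: compact_eq_bounded_closed)
  moreover have "0 \<in> K" using \<gamma> T by (simp add: K_def between_def)
  ultimately obtain t where t: "t \<in> K" "\<And>s. s \<in> K \<Longrightarrow> s \<le> t"
    using compact_attains_sup[of K] by blast
  define w where "w = \<gamma> t"
  have w: "w \<in> between T d x y" "w \<in> between T d x z" "w \<in> T" "d x w = t"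
    using t(1) \<gamma>_point \<gamma>_T by (auto simp: K_def w_def)
  \<comment> \<open>A common point \<open>q\<close> lies on both segments from \<open>x\<close>, at
    parameter \<open>t + d w q\<close>; maximality of \<open>t\<close> forces
    \<open>q = w\<close>.\<close>
  have "between T d y w \<inter> between T d w z = {w}"
  proof -
    have "q = w" if q: "q \<in> between T d y w" "q \<in> between T d w z" for q
    proof -
      have "q \<in> between T d w y" using q(1) by (simp add: between_commute)
      then have qy: "q \<in> between T d x y" "d x q = d x w + d w q"
        using between_trans w T by blast+
      have qz: "q \<in> between T d x z"
        using between_trans q w T by blast
      have "q \<in> T" using q by (simp add: between_def)
      have ran: "d x q \<in> {0..d x y}"
        using qy(1) nonneg[of q y] nonneg[of x q] by (simp add: between_def del: nonneg)
      have "q = \<gamma> (d x q)"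
        using between_inj[OF T(1,2) qy(1) \<gamma>_point(1)[OF ran]] \<gamma>_point(2)[OF ran] by simp
      with qz ran have "d x q \<in> K" by (simp add: K_def)
      with t(2) qy(2) w(4) have "d w q \<le> 0" by fastforce
      then show ?thesis
        using \<open>q \<in> T\<close> \<open>w \<in> T\<close> nonneg[of w q] zero[of w q] by simp
    qed
    moreover have "w \<in> between T d y w" "w \<in> between T d w z"
      using w(3) by (auto simp: between_def)
    ultimately show ?thesis by blast
  qed
  then have "between T d y w \<union> between T d w z = between T d y z"
    using between_union w(3) T by blast
  moreover have "w \<in> between T d w z"
    using w(3) by (simp add: between_def)
  ultimately have "w \<in> between T d y z" by blast
  with w show ?thesis by blast
qed

lemma four_point: "four_point T d"
  unfolding four_point_def
proof (intro ballI)
  fix x y u z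
  assume T: "x \<in> T" "y \<in> T" "u \<in> T" "z \<in> T"
  obtain v where v: "v \<in> between T d x y" "v \<in> between T d x u" "v \<in> between T d y u"
    using tripod T by blast
  obtain w where w: "w \<in> between T d x u" "w \<in> between T d x z" "w \<in> between T d u z"
    using tripod T by blast
  have in_T: "v \<in> T" "w \<in> T" using v w by (auto simp: between_def)
  \<comment> \<open>Seen from \<open>x\<close>, the segments to \<open>y\<close>, \<open>u\<close>, \<open>z\<close> run together up to the nearer of the two branch points.\<close>
  define t where "t = min (d x v) (d x w)"
  obtain p where p: "p \<in> between T d x v" "d x p = t"
    using between_point_exists[OF T(1) in_T(1), of t] by (auto simp: t_def)
  obtain q where q: "q \<in> between T d x w" "d x q = t"
    using between_point_exists[OF T(1) in_T(2), of t] by (auto simp: t_def)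
  have below: "r \<in> between T d x b"
    if "r \<in> between T d x a" "a \<in> between T d x b" "b \<in> T" for r a b
  proof -
    have "r \<in> between T d a x" "a \<in> between T d b x"
      using that by (auto simp: between_commute)
    then have "r \<in> between T d b x" using between_trans(1) that(3) T(1) by blast
    then show ?thesis by (simp add: between_commute)
  qed
  have "p \<in> between T d x u" "q \<in> between T d x u"
    using below p(1) q(1) v(2) w(1) T(3) by blast+
  then have "p = q"
    using between_inj[OF T(1,3)] p(2) q(2) by simp
  have "p \<in> between T d x y" "p \<in> between T d x z"
    using below[OF p(1) v(1) T(2)] below[OF q(1) w(2) T(4)] \<open>p = q\<close> by auto
  moreover have "d y z \<le> d y p + d p z"
    using triangle[of y p z] T calculation by (auto simp: between_def)
  ultimately have "d y z \<le> d x y + d x z - 2 * t"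
    using p(2) commute[of y p] by (auto simp: between_def)
  \<comment> \<open>Thus \<open>d x v\<close> and \<open>d x w\<close> are the Gromov products at
    \<open>x\<close> of \<open>y\<close>, \<open>u\<close> and of \<open>u\<close>,
    \<open>z\<close>; the preceding bound says that the one of \<open>y\<close>, \<open>z\<close> is
    at least their minimum.\<close>
  moreover have "2 * d x v = d x y + d x u - d y u" "2 * d x w = d x u + d x z - d u z"
    using v w by (auto simp: between_def commute)
  ultimately show "d x u + d y z \<le> max (d x y + d u z) (d y u + d z x)"
    using commute[of z x] by (auto simp: t_def)
qed

end


section \<open>Geodesic spaces with the four-point condition are trees\<close>

context Metric_space
begin

lemma R_tree_if_geodesic_four_point:
  assumes geo: "\<And>x y. x \<in> M \<Longrightarrow> y \<in> M \<Longrightarrow> \<exists>S. geodesic_segment M d x y S"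
    and fp: "four_point M d"
  shows "R_tree M d"
proof -
  have fp': "d x1 x3 + d x2 x4 \<le> max (d x1 x2 + d x3 x4) (d x2 x3 + d x4 x1)"
    if "x1 \<in> M" "x2 \<in> M" "x3 \<in> M" "x4 \<in> M" for x1 x2 x3 x4
    using fp that by (simp add: four_point_def)
  have eqI: "p = q" if "p \<in> M" "q \<in> M" "d p q \<le> 0" for p q
    using that nonneg[of p q] zero[of p q] by linarith
  \<comment> \<open>For \<open>p\<close>, \<open>x\<close>, \<open>q\<close>, \<open>y\<close> both
    sums in the maximum equal \<open>d x y\<close>, which leaves
    \<open>d p q \<le> 0\<close>.\<close>
  have inj: "p = q"
    if "x \<in> M" "y \<in> M" "p \<in> between M d x y" "q \<in> between M d x y" "d x p = d x q" for x y p q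
    using that fp'[of p x q y] by (intro eqI) (auto simp: between_def commute)
  have seg: "S = between M d x y"
    if "x \<in> M" "y \<in> M" "geodesic_segment M d x y S" for x y S
    using that geodesic_segment_eq_between inj by blast
  have pt: "\<exists>p\<in>between M d x y. d x p = t" if "x \<in> M" "y \<in> M" "0 \<le> t" "t \<le> d x y" for x y t
    using geo[of x y] seg[of x y] geodesic_segment_imp_point that by blast
  have "between M d y x \<union> between M d x z = between M d y z"
    if M: "x \<in> M" "y \<in> M" "z \<in> M" and meet: "between M d y x \<inter> between M d x z = {x}" for x y z
  proof -
    \<comment> \<open>The initial pieces of \<open>[x,y]\<close> and \<open>[x,z]\<close> whose length is the Gromov product of \<open>y\<close> and \<open>z\<close> coincide.\<close>
    define t where "t = (d x y + d x z - d y z) / 2"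
    have t: "0 \<le> t" "t \<le> d x y" "t \<le> d x z"
      using triangle[of y x z] triangle[of x y z] triangle[of x z y] M
      by (auto simp: t_def commute)
    obtain p where p: "p \<in> between M d x y" "d x p = t" using pt M t by blast
    obtain q where q: "q \<in> between M d x z" "d x q = t" using pt M t by blast
    have pq: "p \<in> M" "d p y = d x y - t" "q \<in> M" "d q z = d x z - t"
      using p q by (auto simp: between_def)
    \<comment> \<open>By the choice of \<open>t\<close>, both sums in the maximum for
      \<open>p\<close>, \<open>x\<close>, \<open>z\<close>, \<open>y\<close> equal
      \<open>d x y + d x z - t\<close>. So \<open>p\<close> is no farther from \<open>z\<close> than
      \<open>q\<close> is, and the condition for \<open>p\<close>, \<open>x\<close>,
      \<open>q\<close>, \<open>z\<close> then gives \<open>p = q\<close>.\<close>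
    have "d p z \<le> d x z - t"
      using fp'[of p x z y] M pq p(2) t by (simp add: t_def commute max_def field_simps split: if_splits)
    then have "d p q \<le> 0"
      using fp'[of p x q z] M pq p(2) q(2) by (auto simp: commute)
    then have "p = q" using pq eqI by blast
    then have "p = x" using p q meet by (auto simp: between_commute)
    then have "t = 0" using p M by simp
    then have add: "d y x + d x z = d y z" by (simp add: t_def commute)
    have sub: "between M d y x \<subseteq> between M d y z" "between M d x z \<subseteq> between M d y z"
    proof -
      show "between M d y x \<subseteq> between M d y z"
        using triangle[of y _ z] triangle[of _ x z] M add by (fastforce simp: between_def)
      show "between M d x z \<subseteq> between M d y z"
        using triangle[of y _ z] triangle[of y x] M add by (fastforce simp: between_def)
    qed
    \<comment> \<open>The point at the same distance from \<open>y\<close> on one of the two pieces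
      must be \<open>r\<close> by \<open>inj\<close>.\<close>
    moreover have "r \<in> between M d y x \<union> between M d x z" if r: "r \<in> between M d y z" for r
    proof (cases "d y r \<le> d y x")
      case True
      then obtain s where "s \<in> between M d y x" "d y s = d y r"
        using pt[of y x "d y r"] M by auto
      with inj[of y z r s] sub r M show ?thesis by auto
    next
      case False
      have "d y r - d y x \<le> d x z"
        using r add nonneg[of r z] by (simp add: between_def del: nonneg)
      then obtain s where s: "s \<in> between M d x z" "d x s = d y r - d y x"
        using pt[of x z "d y r - d y x"] M False by auto
      then have "s \<in> between M d y z" using sub by auto
      then have "d y s = d y r"
        using s add by (auto simp: between_def)
      then have "r = s" using inj M r \<open>s \<in> between M d y z\<close> by simp
      with s show ?thesis by blast
    qed
    ultimately show ?thesis by blast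
  qed
  then have union: "S1 \<union> S2 = S3"
    if "x \<in> M" "y \<in> M" "z \<in> M" "geodesic_segment M d y x S1" "geodesic_segment M d x z S2"
      "geodesic_segment M d y z S3" "S1 \<inter> S2 = {x}" for x y z S1 S2 S3
    using that seg by metis
  have unique: "\<exists>!S. geodesic_segment M d x y S" if "x \<in> M" "y \<in> M" for x y
    using geo seg that by metis
  show ?thesis
    unfolding R_tree_def
  proof (intro conjI ballI allI impI)
    fix x y z S1 S2 S3
    assume "x \<in> M" "y \<in> M" "z \<in> M" "geodesic_segment M d y x S1" "geodesic_segment M d x z S2"
      "geodesic_segment M d y z S3" "S1 \<inter> S2 = {x}"
    then show "S1 \<union> S2 = S3" by (rule union)
  qed (fact Metric_space_axioms, fact unique)
qed

end

section \<open>The tree spanned by a four-point space\<close>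

locale pointed_four_point_space = Metric_space X d for X :: "'a set" and d +
  fixes b :: 'a
  assumes base: "b \<in> X" and four_point: "four_point X d"
begin

definition gromov :: "'a \<Rightarrow> 'a \<Rightarrow> real"
  where "gromov x y = (d b x + d b y - d x y) / 2"

text \<open>The point at height \<open>t\<close> on the segment from \<open>b\<close> to \<open>x\<close> is encoded by
  the heights at which the segments from \<open>b\<close> to the points of \<open>X\<close> branch off from the one leading to it.\<close>

definition branch :: "'a \<Rightarrow> real \<Rightarrow> 'a \<Rightarrow> real"
  where "branch x t z = (if z \<in> X then min t (gromov x z) else 0)"

definition tree :: "('a \<Rightarrow> real) set"
  where "tree = {branch x t | x t. x \<in> X \<and> 0 \<le> t \<and> t \<le> d b x}"

text \<open>The height at which the paths from the base to \<open>f\<close> and \<open>g\<close>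
  separate, read off without choosing representatives. For \<open>f\<close> in the tree,
  \<open>meet f f\<close> is the height of \<open>f\<close>.\<close>

definition meet :: "('a \<Rightarrow> real) \<Rightarrow> ('a \<Rightarrow> real) \<Rightarrow> real"
  where "meet f g = (SUP z\<in>X. min (f z) (g z))"

text \<open>The absolute value only matters outside of the tree, where it keeps the function nonnegative.\<close>

definition tree_dist :: "('a \<Rightarrow> real) \<Rightarrow> ('a \<Rightarrow> real) \<Rightarrow> real"
  where "tree_dist f g = \<bar>meet f f + meet g g - 2 * meet f g\<bar>"

lemma gromov_commute: "gromov x y = gromov y x"
  by (simp add: gromov_def commute)

lemma gromov_self: "x \<in> X \<Longrightarrow> gromov x x = d b x"
  by (simp add: gromov_def)

lemma gromov_bounds:
  assumes "x \<in> X" "y \<in> X"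
  shows "0 \<le> gromov x y" "gromov x y \<le> d b x" "gromov x y \<le> d b y"
  using triangle[of x b y] triangle[of b x y] triangle[of b y x] base assms
  by (auto simp: gromov_def commute)

text \<open>This is the four-point condition for \<open>b\<close>, \<open>x\<close>,
  \<open>y\<close>, \<open>z\<close>.\<close>

lemma gromov_hyperbolic:
  assumes "x \<in> X" "y \<in> X" "z \<in> X"
  shows "min (gromov x y) (gromov y z) \<le> gromov x z"
proof -
  have "d b y + d x z \<le> max (d b x + d y z) (d x y + d z b)"
    using four_point base assms by (simp add: four_point_def)
  then show ?thesis by (auto simp: gromov_def commute min_def max_def split: if_splits)
qed

text \<open>The supremum is attained at \<open>z = x\<close>, and \<open>gromov_hyperbolic\<close>
  bounds every other term.\<close>

lemma meet_branch:
  assumes "x \<in> X" "s \<le> d b x" "y \<in> X" "t \<le> d b y"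
  shows "meet (branch x s) (branch y t) = min (min s t) (gromov x y)"
  unfolding meet_def
proof (rule cSup_eq_maximum)
  have "min (branch x s x) (branch y t x) = min (min s t) (gromov x y)"
    using assms by (auto simp: branch_def gromov_self gromov_commute[of y x])
  then show "min (min s t) (gromov x y) \<in> (\<lambda>z. min (branch x s z) (branch y t z)) ` X"
    using assms(1) by (intro image_eqI[of _ _ x]) simp_all
next
  fix u assume "u \<in> (\<lambda>z. min (branch x s z) (branch y t z)) ` X"
  then obtain z where "z \<in> X" "u = min (branch x s z) (branch y t z)" by blast
  then show "u \<le> min (min s t) (gromov x y)"
    using gromov_hyperbolic[of x z y] assms
    by (auto simp: branch_def gromov_commute[of z y])
qed

lemma meet_commute: "meet f g = meet g f"
  by (simp add: meet_def min.commute)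

lemma branch_in_tree: "x \<in> X \<Longrightarrow> 0 \<le> t \<Longrightarrow> t \<le> d b x \<Longrightarrow> branch x t \<in> tree"
  unfolding tree_def by blast

lemma treeE:
  assumes "f \<in> tree"
  obtains x t where "f = branch x t" "x \<in> X" "0 \<le> t" "t \<le> d b x"
  using assms unfolding tree_def by blast

lemma meet_hyperbolic:
  assumes "f \<in> tree" "g \<in> tree" "h \<in> tree"
  shows "min (meet f g) (meet g h) \<le> meet f h"
proof -
  obtain x s where f: "f = branch x s" "x \<in> X" "s \<le> d b x" using assms(1) by (rule treeE)
  obtain y t where g: "g = branch y t" "y \<in> X" "t \<le> d b y" using assms(2) by (rule treeE)
  obtain z u where h: "h = branch z u" "z \<in> X" "u \<le> d b z" using assms(3) by (rule treeE)
  show ?thesis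
    using gromov_hyperbolic[of x y z] f g h by (auto simp: meet_branch)
qed

lemma meet_le:
  assumes "f \<in> tree" "g \<in> tree"
  shows "meet f g \<le> meet f f" "meet f g \<le> meet g g"
proof -
  obtain x s where f: "f = branch x s" "x \<in> X" "s \<le> d b x" using assms(1) by (rule treeE)
  obtain y t where g: "g = branch y t" "y \<in> X" "t \<le> d b y" using assms(2) by (rule treeE)
  show "meet f g \<le> meet f f" "meet f g \<le> meet g g"
    using f g by (auto simp: meet_branch gromov_self)
qed

lemma tree_dist_eq:
  assumes "f \<in> tree" "g \<in> tree"
  shows "tree_dist f g = meet f f + meet g g - 2 * meet f g"
  using meet_le[OF assms] by (simp add: tree_dist_def)

lemma tree_dist_branch:
  assumes "x \<in> X" "0 \<le> s" "s \<le> d b x" "y \<in> X" "0 \<le> t" "t \<le> d b y"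
  shows "tree_dist (branch x s) (branch y t) = s + t - 2 * min (min s t) (gromov x y)"
proof -
  have "branch x s \<in> tree" "branch y t \<in> tree" using assms by (auto intro: branch_in_tree)
  then show ?thesis using assms by (simp add: tree_dist_eq meet_branch gromov_self)
qed

text \<open>Below the Gromov product of \<open>x\<close> and \<open>y\<close>, hyperbolicity makes
  both truncated profiles equal on \<open>X\<close>; outside \<open>X\<close> both take the default
  0.\<close>

lemma branch_eq:
  assumes "x \<in> X" "y \<in> X" "t \<le> gromov x y"
  shows "branch x t = branch y t"
proof
  fix z
  show "branch x t z = branch y t z"
    using gromov_hyperbolic[of x y z] gromov_hyperbolic[of y x z] assms
    by (auto simp: branch_def gromov_commute[of y x])
qed

sublocale tree: Metric_space tree tree_dist
proof
  show "0 \<le> tree_dist f g" for f g by (simp add: tree_dist_def)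
  show "tree_dist f g = tree_dist g f" for f g
    by (simp add: tree_dist_def meet_commute[of g f] add.commute)
  show "tree_dist f g = 0 \<longleftrightarrow> f = g" if fg: "f \<in> tree" "g \<in> tree" for f g
  proof
    assume eq: "tree_dist f g = 0"
    obtain x s where f: "f = branch x s" "x \<in> X" "0 \<le> s" "s \<le> d b x"
      using fg(1) by (rule treeE)
    obtain y t where g: "g = branch y t" "y \<in> X" "0 \<le> t" "t \<le> d b y"
      using fg(2) by (rule treeE)
    have "s = t" "s \<le> gromov x y"
      using eq f g by (auto simp: tree_dist_branch min_def split: if_splits)
    then show "f = g" using f g branch_eq by simp
  qed (simp add: tree_dist_def)
  \<comment> \<open>This amounts to \<open>meet f g + meet g h \<le> meet g g + meet f h\<close>:
    the smaller summand is at most \<open>meet f h\<close>, the other at most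
    \<open>meet g g\<close>.\<close>
  show "tree_dist f h \<le> tree_dist f g + tree_dist g h" if "f \<in> tree" "g \<in> tree" "h \<in> tree" for f g h
    using meet_hyperbolic[of f g h] meet_le[of f g] meet_le[of g h] that
    by (auto simp: tree_dist_eq min_def split: if_splits)
qed

text \<open>The heights cancel, leaving that \<open>meet f h + meet g k\<close> is at least the
  smaller of the other two sums. This follows from the ultrametric inequality on triples by linear
  case analysis.\<close>

lemma four_point_tree: "four_point tree tree_dist"
  unfolding four_point_def
proof (intro ballI)
  fix f g h k assume T: "f \<in> tree" "g \<in> tree" "h \<in> tree" "k \<in> tree"
  have *: "meet p q \<le> meet p r \<or> meet r q \<le> meet p r"
    if "p \<in> tree" "q \<in> tree" "r \<in> tree" for p q r
    using meet_hyperbolic[of p q r] that by (simp add: meet_commute[of q r] min_le_iff_disj)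
  show "tree_dist f h + tree_dist g k \<le> max (tree_dist f g + tree_dist h k) (tree_dist g h + tree_dist k f)"
    using *[of f g h] *[of f k h] *[of g f k] *[of g h k]
      *[of f h g] *[of f k g] *[of g f h] *[of g k h] *[of h f k] *[of h g k] *[of k g f] *[of k h f]
    unfolding tree_dist_eq[OF T(1,3)] tree_dist_eq[OF T(2,4)] tree_dist_eq[OF T(1,2)]
      tree_dist_eq[OF T(3,4)] tree_dist_eq[OF T(2,3)] tree_dist_eq[OF T(4,1)]
      meet_commute[of g f] meet_commute[of h f] meet_commute[of k f]
      meet_commute[of h g] meet_commute[of k g] meet_commute[of k h]
    using T by argo
qed

lemma tree_geodesic:
  assumes "f \<in> tree" "g \<in> tree"
  shows "\<exists>S. geodesic_segment tree tree_dist f g S"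
proof -
  obtain x s where f: "f = branch x s" "x \<in> X" "0 \<le> s" "s \<le> d b x"
    using assms(1) by (rule treeE)
  obtain y t where g: "g = branch y t" "y \<in> X" "0 \<le> t" "t \<le> d b y"
    using assms(2) by (rule treeE)
  define m where "m = min (min s t) (gromov x y)"
  have m: "0 \<le> m" "m \<le> s" "m \<le> t" "m \<le> gromov x y" "m = s \<or> m = t \<or> m = gromov x y"
    using gromov_bounds[of x y] f g by (auto simp: m_def)
  have fg: "tree_dist f g = s + t - 2 * m"
    using f g by (simp add: tree_dist_branch m_def)
  \<comment> \<open>Descend from height \<open>s\<close> to the branching height \<open>m\<close>,
    then climb towards \<open>y\<close>: at time \<open>r\<close> the height is
    \<open>m + (r - (s - m))\<close>.\<close>
  define \<gamma> where "\<gamma> r = (if r \<le> s - m then branch x (s - r) else branch y (r - s + 2 * m))" for r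
  have iso: "tree_dist (\<gamma> r) (\<gamma> r') = r' - r" if "0 \<le> r" "r \<le> r'" "r' \<le> s + t - 2 * m" for r r'
  proof -
    consider "r' \<le> s - m" | "s - m < r" | "r \<le> s - m" "s - m < r'" by linarith
    then show ?thesis
    proof cases
      case 1
      then show ?thesis
        using that f m by (simp add: \<gamma>_def tree_dist_branch gromov_self)
    next
      case 2
      then show ?thesis
        using that g m by (simp add: \<gamma>_def tree_dist_branch gromov_self)
    next
      case 3
      \<comment> \<open>Both heights are at least \<open>m\<close>. If \<open>m\<close> is not the
        Gromov product, it is \<open>s\<close> or \<open>t\<close>, and one leg has length
        zero.\<close>
      have "min (min (s - r) (r' - s + 2 * m)) (gromov x y) = m"
        using that 3 m by linarith
      then show ?thesis
        using that f g m 3 by (simp add: \<gamma>_def tree_dist_branch)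
    qed
  qed
  have "isometric_embedding {0..s + t - 2 * m} dist tree tree_dist \<gamma>"
    unfolding isometric_embedding_def
  proof (intro conjI ballI)
    show "\<gamma> \<in> {0..s + t - 2 * m} \<rightarrow> tree"
      using f g m by (auto simp: \<gamma>_def intro!: branch_in_tree)
    fix r r' assume "r \<in> {0..s + t - 2 * m}" "r' \<in> {0..s + t - 2 * m}"
    then show "tree_dist (\<gamma> r) (\<gamma> r') = dist r r'"
      using iso[of r r'] iso[of r' r] tree.commute[of "\<gamma> r" "\<gamma> r'"]
      by (cases "r \<le> r'") (auto simp: dist_real_def)
  qed
  moreover have "\<gamma> 0 = f" using m f by (simp add: \<gamma>_def)
  \<comment> \<open>When \<open>m = t\<close> the endpoint still falls under the first formula, and
    \<open>branch_eq\<close> identifies \<open>branch x m\<close> with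
    \<open>branch y m\<close>.\<close>
  moreover have "\<gamma> (s + t - 2 * m) = g"
    using m f g branch_eq[of x y m] by (auto simp: \<gamma>_def)
  ultimately show ?thesis
    unfolding geodesic_segment_def fg by blast
qed

lemma R_tree_tree: "R_tree tree tree_dist"
  by (rule tree.R_tree_if_geodesic_four_point[OF tree_geodesic four_point_tree])

lemma embedding_tree: "isometric_embedding X d tree tree_dist (\<lambda>x. branch x (d b x))"
  unfolding isometric_embedding_def
proof (intro conjI ballI)
  show "(\<lambda>x. branch x (d b x)) \<in> X \<rightarrow> tree"
    by (auto intro: branch_in_tree)
  fix x y assume "x \<in> X" "y \<in> X"
  then show "tree_dist (branch x (d b x)) (branch y (d b y)) = d x y"
    using gromov_bounds[of x y] by (auto simp: tree_dist_branch min_absorb2) (simp add: gromov_def field_simps)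
qed

end

section \<open>Assembling the equivalences\<close>

lemma four_point_if_embeds:
  assumes "embeds_in_R_tree TYPE('t) X d"
  shows "four_point X d"
proof -
  obtain T :: "'t set" and dT f where T: "R_tree T dT" and f: "isometric_embedding X d T dT f"
    using assms by (auto simp: embeds_in_R_tree_def)
  interpret R_tree_space T dT
    using T by (simp add: R_tree_space_def R_tree_space_axioms_def R_tree_def)
  have "d x y = dT (f x) (f y)" if "x \<in> X" "y \<in> X" for x y
    using f that by (simp add: isometric_embedding_def)
  moreover have "f x \<in> T" if "x \<in> X" for x
    using f that by (auto simp: isometric_embedding_def)
  ultimately show ?thesis
    using four_point by (simp add: four_point_def)
qed

lemma embeds_if_four_point:
  fixes X :: "'a set"
  assumes "Metric_space X d" and "four_point X d"
  shows "embeds_in_R_tree TYPE('a \<Rightarrow> real) X d"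
proof (cases "X = {}")
  \<comment> \<open>The construction needs a base point, so the empty space gets the empty
    tree.\<close>
  case True
  have "R_tree ({} :: ('a \<Rightarrow> real) set) (\<lambda>_ _. 0)"
    unfolding R_tree_def by (intro conjI Metric_space.intro) simp_all
  moreover from True have "isometric_embedding X d {} (\<lambda>_ _. 0) f" for f :: "'a \<Rightarrow> 'a \<Rightarrow> real"
    by (simp add: isometric_embedding_def)
  ultimately show ?thesis
    unfolding embeds_in_R_tree_def by blast
next
  case False
  then obtain b where "b \<in> X" by blast
  then interpret pointed_four_point_space X d b
    using assms by (simp add: pointed_four_point_space_def pointed_four_point_space_axioms_def)
  show ?thesis
    unfolding embeds_in_R_tree_def using R_tree_tree embedding_tree by blast
qed

(* The trees are taken on the type 'a \<Rightarrow> real, whose cardinality suffices for the union of the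
   geodesic segments between points of X. The last conjunct, in which 't is an arbitrary type,
   says that this choice loses nothing. *)
theorem theorem5:
  fixes X :: "'a set" and d :: "'a \<Rightarrow> 'a \<Rightarrow> real"
  assumes "Metric_space X d"
  shows "(embeds_in_R_tree TYPE('a \<Rightarrow> real) X d \<longleftrightarrow> four_point X d) \<and>
         (four_point X d \<longleftrightarrow> kappa_ptolemy X d) \<and>
         (embeds_in_R_tree TYPE('t) X d \<longrightarrow> embeds_in_R_tree TYPE('a \<Rightarrow> real) X d)"
  using four_point_if_embeds[of X d] embeds_if_four_point[OF assms]
    Metric_space.kappa_ptolemy_if_four_point[OF assms]
    Metric_space.four_point_if_kappa_ptolemy[OF assms]
    four_point_if_embeds[where 't = 't, of X d]
  by blast

end
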